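(* Let $h\geq 2$ be an integer, $p$ a prime, $m,d\geq 1$ integers, and $a,r$ integers with $0\le a<d$ and $0\le r<m$. Then, as $x\to\infty$, \[ \#\{0\le n<x : n \equiv a \bmod d,\ e_p(n^h!)\equiv r \bmod m\}\gg_{p,h,d,m} x^{4/(3h+1)}, \] i.e. the left side is at least $c\,x^{4/(3h+1)}$ for all sufficiently large $x$, where $c>0$ depends only on $p,h,d,m$. Moreover, there is an effectively computable constant $C=C(p,h,d,m)$ such that \[ \{e_p(n^h!) \bmod m:\ 0\le n < C,\ n \equiv a \bmod d\}=\mathbb{Z}_m . \]
   Context: For a prime $p$ and a nonnegative integer $N$, $e_p(N!)$ denotes the exponent of $p$ in the prime factorization of $N!$ (equivalently $e_p(N!)=\sum_{i\ge1}\lfloor N/p^i\rfloor=(N-s_p(N))/(p-1)$, where $s_p(N)$ is the sum of the base-$p$ digits of $N$). $\mathbb{Z}_m$ denotes the set of residue classes modulo $m$. *)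

theory Defs
  imports Complex_Main "HOL-Computational_Algebra.Primes" "HOL-Number_Theory.Cong"
begin

text \<open>
  The total recursive functions of a given arity, with an argument tuple represented as a list of
  that length: the closure of the initial functions under composition, primitive recursion, and
  minimisation of functions that have a zero for all values of the parameters. The values of
  a function on lists of any other length carry no meaning.
\<close>

inductive total_recursive :: "nat \<Rightarrow> (nat list \<Rightarrow> nat) \<Rightarrow> bool" where
  zero: "total_recursive k (\<lambda>xs. 0)"
| succ: "total_recursive 1 (\<lambda>xs. Suc (xs ! 0))"
| proj: "i < k \<Longrightarrow> total_recursive k (\<lambda>xs. xs ! i)"
| comp: "total_recursive (length gs) f \<Longrightarrow> (\<And>g. g \<in> set gs \<Longrightarrow> total_recursive k g) \<Longrightarrow>
    total_recursive k (\<lambda>xs. f (map (\<lambda>g. g xs) gs))"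
| prim_rec: "total_recursive k f \<Longrightarrow> total_recursive (Suc (Suc k)) g \<Longrightarrow>
    total_recursive (Suc k) (\<lambda>xs. rec_nat (f (tl xs)) (\<lambda>y v. g (y # v # tl xs)) (hd xs))"
| minimise: "total_recursive (Suc k) f \<Longrightarrow> (\<And>xs. length xs = k \<Longrightarrow> \<exists>y. f (y # xs) = 0) \<Longrightarrow>
    total_recursive k (\<lambda>xs. LEAST y. f (y # xs) = 0)"

definition effectively_computable4 :: "(nat \<Rightarrow> nat \<Rightarrow> nat \<Rightarrow> nat \<Rightarrow> nat) \<Rightarrow> bool" where
  "effectively_computable4 F \<longleftrightarrow>
     (\<exists>f. total_recursive 4 f \<and> (\<forall>i j k l. F i j k l = f [i, j, k, l]))"

end

theory Submission
  imports Defs "HOL-Computational_Algebra.Polynomial"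
begin

text \<open>
  By Legendre's formula \<open>(p - 1) e\<^sub>p(N!) = N - s\<^sub>p(N)\<close>. Consider \<open>n = t(p ^ k)\<close> for a cubic
  \<open>t = m\<^sub>3 X\<^sup>3 + m\<^sub>2 X\<^sup>2 - m\<^sub>1 X + m\<^sub>0\<close> whose coefficients are positive of size about \<open>B\<close>, except that
  \<open>m\<^sub>1 > 0\<close> is smaller by a constant factor. Then all coefficients of \<open>t ^ h\<close> are positive except that
  of \<open>X\<close>, which is negative. Once \<open>p ^ k\<close> exceeds them all, the single borrow gives
  \<open>s\<^sub>p(n ^ h) = (p - 1) k + M\<close> with \<open>M\<close> independent of \<open>k\<close>. If \<open>m\<^sub>1\<close>, \<open>m\<^sub>2\<close>, \<open>m\<^sub>3\<close> are divisible by
  \<open>d m (p - 1)\<close> and \<open>m\<^sub>0 \<equiv> a\<close> modulo \<open>d\<close>, then \<open>n \<equiv> a\<close> modulo \<open>d\<close> and \<open>e\<^sub>p(n ^ h!) + k\<close> is constant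
  modulo \<open>m\<close>, so that among any \<open>m\<close> consecutive \<open>k\<close> one gives the residue \<open>r\<close>. One can take
  \<open>p ^ k\<close> of order \<open>B ^ h\<close>, hence \<open>n\<close> of order \<open>B ^ (3 h + 1)\<close>, while there are of order
  \<open>B ^ 4\<close> cubics.
\<close>

subsection \<open>Sums of digits\<close>

text \<open>Only the factors \<open>p * j\<close> with \<open>1 \<le> j \<le> N\<close> are
  divisible by \<open>p\<close>, and each contributes one more than \<open>j\<close> does: the
  recursive form of Legendre's formula.\<close>

lemma multiplicity_fact_mult_add:
  fixes p N r :: nat
  assumes p: "prime p" and r: "r < p"
  shows "multiplicity p (fact (p * N + r) :: nat) = N + multiplicity p (fact N :: nat)"
proof -
  have low: "multiplicity p (fact (p * N + r) :: nat) = multiplicity p (fact (p * N) :: nat)"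
    if "r < p" for N r
    using that
  proof (induction r)
    case (Suc r)
    have "\<not> p dvd p * N + Suc r"
      using Suc.prems by (subst dvd_add_right_iff) (auto dest: dvd_imp_le)
    then have "multiplicity p (p * N + Suc r) = 0"
      by (rule not_dvd_imp_multiplicity_0)
    then show ?case
      using Suc p by (simp add: prime_elem_multiplicity_mult_distrib del: mult_Suc_right mult_Suc)
  qed simp
  have "multiplicity p (fact (p * N) :: nat) = N + multiplicity p (fact N :: nat)"
  proof (induction N)
    case (Suc N)
    obtain q where q: "p = Suc q"
      using p by (metis not0_implies_Suc not_prime_0)
    \<comment> \<open>\<open>p * Suc N\<close> succeeds \<open>p * N + q\<close>, so the top factor
      splits off and \<open>low\<close> disposes of the \<open>q\<close> factors below it.\<close>
    have "fact (p * Suc N) = (p * Suc N) * (fact (p * N + q) :: nat)"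
      using fact_Suc[of "p * N + q", where ?'a = nat] by (simp add: q algebra_simps)
    then have "multiplicity p (fact (p * Suc N) :: nat) =
        1 + multiplicity p (Suc N) + multiplicity p (fact (p * N + q) :: nat)"
      using p prime_gt_1_nat[OF p] by (simp add: prime_elem_multiplicity_mult_distrib del: mult_Suc_right)
    also have "multiplicity p (fact (p * N + q) :: nat) = N + multiplicity p (fact N :: nat)"
      using low[of q N] Suc.IH q by simp
    finally show ?case
      using p by (simp add: prime_elem_multiplicity_mult_distrib del: mult_Suc)
  qed simp
  with low[OF r] show ?thesis
    by simp
qed

text \<open>Legendre's formula serves as the definition of the sum of the base-\<open>p\<close> digits.\<close>

definition digit_sum :: "nat \<Rightarrow> nat \<Rightarrow> int" where
  "digit_sum p N = int N - (int p - 1) * int (multiplicity p (fact N :: nat))"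

text \<open>Splitting off the last digit \<open>r\<close> adds \<open>r\<close>; with the value at 0
  this recursion shows that the definition does give the digit sum.\<close>

lemma digit_sum_mult_add:
  assumes "prime p" "r < p"
  shows "digit_sum p (p * N + r) = int r + digit_sum p N"
  using multiplicity_fact_mult_add[OF assms, of N] by (simp add: digit_sum_def algebra_simps)

lemma digit_sum_0 [simp]: "digit_sum p 0 = 0"
  by (simp add: digit_sum_def)

lemma digit_sum_div_mod:
  assumes "prime p"
  shows "digit_sum p N = int (N mod p) + digit_sum p (N div p)"
  using digit_sum_mult_add[OF assms, of "N mod p" "N div p"] prime_gt_0_nat[OF assms] by simp

text \<open>\<open>r\<close> fills the lowest \<open>k\<close> digits and \<open>N\<close> the rest,
  so nothing carries; the induction peels off the lowest digit.\<close>

lemma digit_sum_power_mult_add: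
  assumes p: "prime p" and "r < p ^ k"
  shows "digit_sum p (p ^ k * N + r) = digit_sum p N + digit_sum p r"
  using assms(2)
proof (induction k arbitrary: r)
  case (Suc k)
  have p0: "p > 0"
    using p by (rule prime_gt_0_nat)
  have "p ^ Suc k * N + r = p * (p ^ k * N + r div p) + r mod p"
    by (simp add: algebra_simps)
  then have "digit_sum p (p ^ Suc k * N + r) = int (r mod p) + digit_sum p (p ^ k * N + r div p)"
    using digit_sum_mult_add[OF p, of "r mod p"] p0 by simp
  also have "r div p < p ^ k"
    using Suc.prems by (simp add: less_mult_imp_div_less mult.commute)
  then have "digit_sum p (p ^ k * N + r div p) = digit_sum p N + digit_sum p (r div p)"
    by (rule Suc.IH)
  finally show ?case
    using digit_sum_div_mod[OF p, of r] by simp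
qed simp

text \<open>All \<open>k\<close> digits of \<open>p ^ k - 1\<close> are \<open>p - 1\<close>, so
  subtracting \<open>b\<close> never borrows and turns each digit \<open>x\<close> of
  \<open>b\<close> into \<open>p - 1 - x\<close>.\<close>

lemma digit_sum_complement:
  assumes p: "prime p" and "b < p ^ k"
  shows "digit_sum p (p ^ k - 1 - b) = (int p - 1) * int k - digit_sum p b"
  using assms(2)
proof (induction k arbitrary: b)
  case (Suc k)
  have p0: "p > 0"
    using p by (rule prime_gt_0_nat)
  have b: "b div p < p ^ k"
    using Suc.prems by (simp add: less_mult_imp_div_less mult.commute)
  have m: "b mod p < p"
    using p0 by simp
  have "int (p ^ Suc k - 1 - b) = int (p * (p ^ k - 1 - b div p) + (p - 1 - b mod p))"
  proof -
    have b_eq: "int b = int p * int (b div p) + int (b mod p)"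
      by (metis mult_div_mod_eq of_nat_add of_nat_mult)
    have div_eq: "int (p ^ k - 1 - b div p) = int p ^ k - 1 - int (b div p)"
      using b by (simp add: of_nat_diff)
    have mod_eq: "int (p - 1 - b mod p) = int p - 1 - int (b mod p)"
      using m by (simp add: of_nat_diff)
    have lhs_eq: "int (p ^ Suc k - 1 - b) = int p * int p ^ k - 1 - int b"
      using Suc.prems by (simp add: of_nat_diff)
    show ?thesis
      unfolding of_nat_add of_nat_mult lhs_eq div_eq mod_eq using b_eq by (simp add: algebra_simps)
  qed
  then have "p ^ Suc k - 1 - b = p * (p ^ k - 1 - b div p) + (p - 1 - b mod p)"
    by (simp only: of_nat_eq_iff)
  then have "digit_sum p (p ^ Suc k - 1 - b) =
      int (p - 1 - b mod p) + digit_sum p (p ^ k - 1 - b div p)"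
    using digit_sum_mult_add[OF p, of "p - 1 - b mod p"] p0 by simp
  also have "\<dots> = int p - 1 - int (b mod p) + ((int p - 1) * int k - digit_sum p (b div p))"
    using Suc.IH[OF b] m by (simp add: of_nat_diff)
  finally show ?case
    using digit_sum_div_mod[OF p, of b] by (simp add: algebra_simps)
qed simp

lemma poly_nonneg_of_coeff_nonneg:
  fixes q :: "'a :: linordered_idom poly"
  assumes "\<forall>i. coeff q i \<ge> 0" "x \<ge> 0"
  shows "poly q x \<ge> 0"
  unfolding poly_altdef using assms by (intro sum_nonneg) simp

text \<open>Coefficients below \<open>p ^ k\<close> occupy disjoint blocks of \<open>k\<close>
  digits, so \<open>M\<close> is the sum of their digit sums, whatever \<open>k\<close> is.\<close>

lemma digit_sum_poly:
  fixes q :: "int poly"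
  assumes p: "prime p" and "\<forall>i. coeff q i \<ge> 0"
  shows "\<exists>M. \<forall>k. (\<forall>i. coeff q i < int p ^ k) \<longrightarrow> digit_sum p (nat (poly q (int p ^ k))) = M"
  using assms(2)
proof (induction q)
  case (pCons c q)
  have c: "c \<ge> 0" and q: "\<forall>i. coeff q i \<ge> 0"
    using pCons.prems by (auto simp: coeff_pCons split: nat.splits)
  obtain M where M: "\<And>k. (\<forall>i. coeff q i < int p ^ k) \<Longrightarrow>
      digit_sum p (nat (poly q (int p ^ k))) = M"
    using pCons.IH[OF q] by blast
  have "digit_sum p (nat (poly (pCons c q) (int p ^ k))) = M + digit_sum p (nat c)"
    if "\<forall>i. coeff (pCons c q) i < int p ^ k" for k
  proof -
    have ck: "c < int p ^ k" and qk: "\<forall>i. coeff q i < int p ^ k"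
      using that by (auto simp: coeff_pCons split: nat.splits)
    have pos: "poly q (int p ^ k) \<ge> 0"
      using q by (rule poly_nonneg_of_coeff_nonneg) simp
    have "nat (poly (pCons c q) (int p ^ k)) = p ^ k * nat (poly q (int p ^ k)) + nat c"
      using c pos by (simp add: nat_add_distrib nat_mult_distrib nat_power_eq)
    moreover have "nat c < p ^ k"
      using c ck by (simp add: nat_less_iff)
    ultimately show ?thesis
      using digit_sum_power_mult_add[OF p] M[OF qk] by simp
  qed
  then show ?case
    by blast
qed auto

text \<open>The negative coefficient borrows from its neighbour, which produces a block of \<open>k\<close> digits
  that are mostly \<open>p - 1\<close>.\<close>

lemma digit_sum_poly_borrow:
  fixes q :: "int poly"
  assumes p: "prime p"
    and nonneg: "\<forall>i. i \<noteq> 1 \<longrightarrow> coeff q i \<ge> 0"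
    and neg: "coeff q 1 < 0" and pos: "coeff q 2 > 0"
  shows "\<exists>M. \<forall>k. (\<forall>i. \<bar>coeff q i\<bar> < int p ^ k) \<longrightarrow>
    digit_sum p (nat (poly q (int p ^ k))) = (int p - 1) * int k + M"
proof -
  obtain c0 c1 q' where q: "q = pCons c0 (pCons c1 q')"
    by (metis pCons_cases)
  \<comment> \<open>The unit is borrowed from the coefficient of X^2 and raises the linear
    coefficient \<open>c1\<close> to \<open>p ^ k + c1\<close>.\<close>
  define r where "r = q' - 1"
  have c: "c0 \<ge> 0" "c1 < 0" "coeff q' 0 > 0"
    using nonneg[rule_format, of 0] neg pos by (simp_all add: q numeral_2_eq_2)
  have q': "coeff q' i \<ge> 0" for i
    using nonneg[rule_format, of "Suc (Suc i)"] by (simp add: q)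
  have r: "\<forall>i. coeff r i \<ge> 0"
    using q' c(3) by (auto simp: r_def coeff_1 split: nat.splits)
  obtain M where M: "\<And>k. (\<forall>i. coeff r i < int p ^ k) \<Longrightarrow>
      digit_sum p (nat (poly r (int p ^ k))) = M"
    using digit_sum_poly[OF p r] by blast
  \<comment> \<open>Chosen so that \<open>p ^ k + c1 = p ^ k - 1 - b\<close>, whose digit sum is
    \<open>(p - 1) * k\<close> minus a constant by \<open>digit_sum_complement\<close>.\<close>
  define b where "b = nat (- c1 - 1)"
  have "digit_sum p (nat (poly q (int p ^ k))) =
      (int p - 1) * int k + (M - digit_sum p b + digit_sum p (nat c0))"
    if k: "\<forall>i. \<bar>coeff q i\<bar> < int p ^ k" for k
  proof -
    have c0k: "nat c0 < p ^ k" and c1k: "- c1 < int p ^ k"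
      using k[rule_format, of 0] k[rule_format, of 1] c by (auto simp: q nat_less_iff)
    have rk: "coeff r i < int p ^ k" for i
      using k[rule_format, of "Suc (Suc i)"] by (auto simp: q r_def coeff_1 split: if_splits)
    have b: "int b = - c1 - 1" "b < p ^ k"
      using c c1k by (auto simp: b_def nat_less_iff)
    have b': "int (p ^ k - 1 - b) = int p ^ k + c1"
      using b by (simp add: of_nat_diff)
    define z where "z = nat (poly r (int p ^ k))"
    have z: "int z = poly r (int p ^ k)"
      using poly_nonneg_of_coeff_nonneg[OF r, of "int p ^ k"] by (simp add: z_def)
    have "poly q (int p ^ k) = int (p ^ k * (p ^ k * z + (p ^ k - 1 - b)) + nat c0)"
      using c(1) unfolding of_nat_add of_nat_mult b' z by (simp add: q r_def algebra_simps)
    then have "nat (poly q (int p ^ k)) = p ^ k * (p ^ k * z + (p ^ k - 1 - b)) + nat c0"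
      by (simp only: nat_int)
    moreover have "p ^ k - 1 - b < p ^ k"
      using b(2) by linarith
    ultimately have "digit_sum p (nat (poly q (int p ^ k))) =
        digit_sum p z + digit_sum p (p ^ k - 1 - b) + digit_sum p (nat c0)"
      using c0k by (simp only: digit_sum_power_mult_add[OF p])
    then show ?thesis
      using M[of k] rk digit_sum_complement[OF p b(2)] by (simp add: z_def)
  qed
  then show ?thesis
    by blast
qed

subsection \<open>Signs of the coefficients of powers of a cubic\<close>

lemma coeff_cubic_mult:
  fixes f :: "'a :: comm_ring_1 poly"
  shows "coeff ([:a, b, c, e:] * f) i = a * coeff f i + (if i \<ge> 1 then b * coeff f (i - 1) else 0)
    + (if i \<ge> 2 then c * coeff f (i - 2) else 0) + (if i \<ge> 3 then e * coeff f (i - 3) else 0)"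
proof -
  have "[:a, b, c, e:] * f =
      smult a f + pCons 0 (smult b f + pCons 0 (smult c f + pCons 0 (smult e f)))"
    by simp
  then show ?thesis
    by (simp only: coeff_add coeff_smult coeff_pCons') (auto simp: algebra_simps numeral_eq_Suc)
qed

lemma abs_coeff_cubic_mult_le:
  fixes f :: "'a :: linordered_idom poly"
  assumes f: "\<And>i. \<bar>coeff f i\<bar> \<le> M"
  shows "\<bar>coeff ([:a, b, c, e:] * f) i\<bar> \<le> (\<bar>a\<bar> + \<bar>b\<bar> + \<bar>c\<bar> + \<bar>e\<bar>) * M"
proof -
  have M: "M \<ge> 0"
    using f[of 0] by linarith
  have *: "\<bar>x * coeff f j\<bar> \<le> \<bar>x\<bar> * M" "\<bar>if P then x * coeff f j else 0\<bar> \<le> \<bar>x\<bar> * M" for x j P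
    using f[of j] M by (auto simp: abs_mult intro!: mult_left_mono)
  have "\<bar>coeff ([:a, b, c, e:] * f) i\<bar> \<le> \<bar>a\<bar> * M + \<bar>b\<bar> * M + \<bar>c\<bar> * M + \<bar>e\<bar> * M"
    unfolding coeff_cubic_mult
    by (intro order_trans[OF abs_triangle_ineq] add_mono *)
  then show ?thesis
    by (simp add: algebra_simps)
qed

lemma abs_coeff_cubic_power_le:
  fixes a b c e :: "'a :: linordered_idom"
  shows "\<bar>coeff ([:a, b, c, e:] ^ h) i\<bar> \<le> (\<bar>a\<bar> + \<bar>b\<bar> + \<bar>c\<bar> + \<bar>e\<bar>) ^ h"
proof (induction h arbitrary: i)
  case 0
  then show ?case by (simp add: coeff_1)
next
  case (Suc h)
  show ?case
    using abs_coeff_cubic_mult_le[OF Suc.IH] by (simp only: power_Suc)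
qed

text \<open>Every exponent up to \<open>3 * h\<close> other than 1 is a sum of \<open>h\<close>
  terms from 0, 2, 3. The matching product of coefficients is at least \<open>B ^ h\<close>, and
  nothing cancels it.\<close>

lemma coeff_gap_cubic_power_ge:
  fixes a c e B :: "'a :: linordered_idom"
  assumes B: "B \<ge> 0" "a \<ge> B" "c \<ge> B" "e \<ge> B"
  shows "coeff ([:a, 0, c, e:] ^ h) i \<ge> 0 \<and>
    (i \<noteq> 1 \<longrightarrow> i \<le> 3 * h \<longrightarrow> coeff ([:a, 0, c, e:] ^ h) i \<ge> B ^ h)"
proof (induction h arbitrary: i)
  case 0
  then show ?case by (simp add: coeff_1)
next
  case (Suc h)
  define f where "f = [:a, 0, c, e:] ^ h"
  have f0: "coeff f j \<ge> 0" for j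
    using Suc.IH by (simp add: f_def)
  have f1: "coeff f j \<ge> B ^ h" if "j \<noteq> 1" "j \<le> 3 * h" for j
    using Suc.IH that by (simp add: f_def)
  have eq: "coeff ([:a, 0, c, e:] ^ Suc h) i = a * coeff f i
    + (if i \<ge> 2 then c * coeff f (i - 2) else 0) + (if i \<ge> 3 then e * coeff f (i - 3) else 0)"
    unfolding power_Suc f_def[symmetric] coeff_cubic_mult by simp
  have nonneg: "0 \<le> a * coeff f j" "0 \<le> c * coeff f j" "0 \<le> e * coeff f j" for j
    using f0 B by simp_all
  have large: "B ^ Suc h \<le> y * coeff f j" if "y \<ge> B" "j \<noteq> 1" "j \<le> 3 * h" for y j
    using f1[OF that(2,3)] that(1) B(1) by (auto intro!: mult_mono)
  have "coeff ([:a, 0, c, e:] ^ Suc h) i \<ge> 0"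
    unfolding eq using nonneg by simp
  moreover have "coeff ([:a, 0, c, e:] ^ Suc h) i \<ge> B ^ Suc h" if i: "i \<noteq> 1" "i \<le> 3 * Suc h"
  proof (cases "i \<le> 3 * h")
    case True
    then show ?thesis
      unfolding eq using large[of a i] B(2) i(1) nonneg by (auto intro!: add_increasing2)
  next
    case False
    \<comment> \<open>A new top exponent is reached through X^3, except that 2 is too small for this
      and 4 would need the missing exponent 1; these two use X^2.\<close>
    show ?thesis
    proof (cases "i = 2 \<or> i = 4")
      case True
      have "B ^ Suc h \<le> c * coeff f (i - 2)"
        by (rule large) (use True False i B in auto)
      moreover have "2 \<le> i"
        using True by auto
      ultimately show ?thesis
        unfolding eq using nonneg(1)[of i] nonneg(3)[of "i - 3"] by (auto simp del: power_Suc)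
    next
      case no: False
      have i3: "i \<ge> 3"
        using i(1) False no by auto
      have "B ^ Suc h \<le> e * coeff f (i - 3)"
        by (rule large) (use no False i i3 B in auto)
      then show ?thesis
        unfolding eq using nonneg i3 by (auto intro!: add_increasing)
    qed
  qed
  ultimately show ?case
    by blast
qed

text \<open>Induction through \<open>s * f - u * g = s * (f - g) - w * g\<close> with
  \<open>w\<close> the linear term \<open>b\<close> X. The factor \<open>B\<close> on the left
  avoids a division.\<close>

lemma coeff_cubic_power_perturbation:
  fixes a b c e B :: "'a :: linordered_idom"
  assumes "0 \<le> a" "a \<le> 2 * B" "0 \<le> b" "b \<le> B" "0 \<le> c" "c \<le> 2 * B" "0 \<le> e" "e \<le> 2 * B"
  shows "B * \<bar>coeff ([:a, - b, c, e:] ^ h) i - coeff ([:a, 0, c, e:] ^ h) i\<bar> \<le> b * (16 * B) ^ h"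
proof (induction h arbitrary: i)
  case (Suc h)
  define f where "f = [:a, - b, c, e:] ^ h"
  define g where "g = [:a, 0, c, e:] ^ h"
  have B: "B \<ge> 0"
    using assms by linarith
  have "B * \<bar>coeff (s * f) i - coeff (u * g) i\<bar>
      = \<bar>coeff (s * smult B (f - g)) i - B * coeff (w * g) i\<bar>" if "u = s + w" for s u w
  proof -
    have "s * f - u * g = s * (f - g) - w * g"
      using that by (simp add: algebra_simps)
    then show ?thesis
      using B by (simp add: abs_mult flip: coeff_diff right_diff_distrib)
  qed
  from this[of "[:a, 0, c, e:]" "[:a, - b, c, e:]" "[:0, b, 0, 0:]"]
  have "B * \<bar>coeff ([:a, - b, c, e:] ^ Suc h) i - coeff ([:a, 0, c, e:] ^ Suc h) i\<bar>
      = \<bar>coeff ([:a, - b, c, e:] * smult B (f - g)) i - B * coeff ([:0, b, 0, 0:] * g) i\<bar>"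
    unfolding power_Suc f_def[symmetric] g_def[symmetric] by simp
  also have "\<dots> \<le> \<bar>coeff ([:a, - b, c, e:] * smult B (f - g)) i\<bar> + B * \<bar>coeff ([:0, b, 0, 0:] * g) i\<bar>"
    using abs_triangle_ineq4[of "coeff ([:a, - b, c, e:] * smult B (f - g)) i" "B * coeff ([:0, b, 0, 0:] * g) i"]
     B by (simp add: abs_mult)
  also have "\<dots> \<le> 8 * B * (b * (16 * B) ^ h) + B * (b * (8 * B) ^ h)"
  proof (intro add_mono mult_left_mono)
    have "\<bar>coeff (smult B (f - g)) j\<bar> \<le> b * (16 * B) ^ h" for j
      using Suc.IH[of j] B by (simp add: f_def g_def abs_mult)
    from abs_coeff_cubic_mult_le[OF this]
    have "\<bar>coeff ([:a, - b, c, e:] * smult B (f - g)) i\<bar>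
        \<le> (\<bar>a\<bar> + \<bar>- b\<bar> + \<bar>c\<bar> + \<bar>e\<bar>) * (b * (16 * B) ^ h)" .
    also have "\<dots> \<le> 8 * B * (b * (16 * B) ^ h)"
      using assms B by (intro mult_right_mono) auto
    finally show "\<bar>coeff ([:a, - b, c, e:] * smult B (f - g)) i\<bar> \<le> 8 * B * (b * (16 * B) ^ h)" .
    have "\<bar>coeff g j\<bar> \<le> (8 * B) ^ h" for j
      unfolding g_def
      by (rule order_trans[OF abs_coeff_cubic_power_le], rule power_mono) (use assms B in auto)
    from abs_coeff_cubic_mult_le[OF this, of 0 b 0 0]
    show "\<bar>coeff ([:0, b, 0, 0:] * g) i\<bar> \<le> b * (8 * B) ^ h"
      using assms by simp
  qed (rule B)
  also have "\<dots> \<le> 8 * B * (b * (16 * B) ^ h) + B * (b * (16 * B) ^ h)"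
    using assms B by (intro add_left_mono mult_left_mono power_mono) auto
  also have "\<dots> = 9 * (B * (b * (16 * B) ^ h))"
    by (simp add: algebra_simps)
  \<comment> \<open>The old error grows by the coefficient sum, at most \<open>8 * B\<close>, and
    the new term adds at most one more \<open>B\<close>; base 16 leaves room for both.\<close>
  also have "\<dots> \<le> 16 * (B * (b * (16 * B) ^ h))"
    using assms B by (intro mult_right_mono) auto
  finally show ?case
    by (simp add: algebra_simps)
qed (use assms in simp)

text \<open>The exponent 1 is the only one up to \<open>3 * h\<close> missing from the powers of \<open>a + c X\<^sup>2 + e X\<^sup>3\<close>;
  a small linear term then controls the sign of that coefficient and does not affect the others.\<close>

lemma coeff_cubic_power_signs:
  fixes a b c e B :: int
  assumes "B \<le> a" "a \<le> 2 * B" "0 < b" "16 ^ h * b < B" "B \<le> c" "c \<le> 2 * B" "B \<le> e" "e \<le> 2 * B"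
    and h: "h \<ge> 1"
  shows "\<forall>i. i \<noteq> 1 \<longrightarrow> coeff ([:a, - b, c, e:] ^ h) i \<ge> 0"
    and "coeff ([:a, - b, c, e:] ^ h) 1 < 0"
    and "coeff ([:a, - b, c, e:] ^ h) 2 > 0"
    and "\<bar>coeff ([:a, - b, c, e:] ^ h) i\<bar> \<le> (8 * B) ^ h"
proof -
  have "1 * b \<le> 16 ^ h * b"
    using assms by (intro mult_right_mono) auto
  then have bB: "b \<le> B" and B: "B > 0"
    using assms by linarith+
  have pos: "coeff ([:a, - b, c, e:] ^ h) i > 0" if i: "i \<noteq> 1" "i \<le> 3 * h" for i
  proof -
    define s where "s = coeff ([:a, - b, c, e:] ^ h) i"
    define t where "t = coeff ([:a, 0, c, e:] ^ h) i"
    have t: "t \<ge> B ^ h"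
      using coeff_gap_cubic_power_ge[of B a c e h i] assms B i by (simp add: t_def)
    \<comment> \<open>By \<open>16 ^ h * b < B\<close> the perturbation is smaller than
      \<open>B ^ h \<le> t\<close>, so \<open>s\<close> stays positive.\<close>
    have "B * (t - s) \<le> B * \<bar>s - t\<bar>"
      using B by (intro mult_left_mono) auto
    also have "\<dots> \<le> b * (16 * B) ^ h"
      unfolding s_def t_def using assms B bB by (intro coeff_cubic_power_perturbation) auto
    also have "\<dots> = (16 ^ h * b) * B ^ h"
      by (simp add: power_mult_distrib)
    also have "\<dots> < B * B ^ h"
      using assms B by (intro mult_strict_right_mono) auto
    also have "\<dots> \<le> B * t"
      using t B by simp
    finally have "B * s > 0"
      by (simp add: algebra_simps)
    then show ?thesis
      using B by (simp add: s_def zero_less_mult_iff)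
  qed
  show "\<forall>i. i \<noteq> 1 \<longrightarrow> coeff ([:a, - b, c, e:] ^ h) i \<ge> 0"
  proof (intro allI impI)
    fix i :: nat assume "i \<noteq> 1"
    show "coeff ([:a, - b, c, e:] ^ h) i \<ge> 0"
    proof (cases "i \<le> 3 * h")
      case False
      have "degree ([:a, - b, c, e:] ^ h) \<le> degree [:a, - b, c, e:] * h"
        by (rule degree_power_le)
      also have "\<dots> \<le> 3 * h"
        by (intro mult_right_mono) auto
      finally show ?thesis
        using False by (simp add: coeff_eq_0)
    qed (use pos \<open>i \<noteq> 1\<close> in force)
  qed
  show "coeff ([:a, - b, c, e:] ^ h) 2 > 0"
    using pos[of 2] h by simp
  have c0: "coeff ([:a, - b, c, e:] ^ n) 0 > 0" for n
    using assms B by (induction n) (auto simp: coeff_cubic_mult)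
  \<comment> \<open>The coefficient is \<open>- (n + 1) * a ^ n * b\<close>; the induction tracks
    just its sign.\<close>
  have "coeff ([:a, - b, c, e:] ^ Suc n) 1 < 0" for n
  proof (induction n)
    case 0
    then show ?case using assms by simp
  next
    case (Suc n)
    have "coeff ([:a, - b, c, e:] ^ Suc (Suc n)) 1 =
        a * coeff ([:a, - b, c, e:] ^ Suc n) 1 - b * coeff ([:a, - b, c, e:] ^ Suc n) 0"
      by (subst power_Suc, subst coeff_cubic_mult) simp
    moreover have "a * coeff ([:a, - b, c, e:] ^ Suc n) 1 < 0"
      using Suc assms B by (intro mult_pos_neg) auto
    moreover have "b * coeff ([:a, - b, c, e:] ^ Suc n) 0 > 0"
      using c0[of "Suc n"] assms by (intro mult_pos_pos) auto
    ultimately show ?case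
      by linarith
  qed
  from this[of "h - 1"] show "coeff ([:a, - b, c, e:] ^ h) 1 < 0"
    using h by simp
  show "\<bar>coeff ([:a, - b, c, e:] ^ h) i\<bar> \<le> (8 * B) ^ h"
    by (rule order_trans[OF abs_coeff_cubic_power_le], rule power_mono) (use assms B bB in auto)
qed

subsection \<open>Counting values of cubics\<close>

text \<open>The quadratic term outweighs the linear one since \<open>b \<le> B \<le> c\<close>. Each
  positive term is at most \<open>2 * B * x ^ 3\<close>, and \<open>b * x > 0\<close> gives
  strictness.\<close>

lemma poly_cubic_bounds:
  fixes a b c e B x :: int
  assumes "B \<le> a" "a \<le> 2 * B" "0 < b" "b \<le> B" "B \<le> c" "c \<le> 2 * B" "B \<le> e" "e \<le> 2 * B" "x \<ge> 1"
  shows "0 \<le> poly [:a, - b, c, e:] x" "poly [:a, - b, c, e:] x < 6 * B * x ^ 3"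
proof -
  have eq: "poly [:a, - b, c, e:] x = a - b * x + c * x ^ 2 + e * x ^ 3"
    by (simp add: algebra_simps power2_eq_square power3_eq_cube)
  have B: "B > 0"
    using assms by linarith
  have x: "1 \<le> x ^ 3" "x \<le> x ^ 2" "x ^ 2 \<le> x ^ 3"
    using assms(9) by (auto intro: power_increasing[of 1 2 x, simplified] power_increasing)
  have "b * x \<le> c * x ^ 2"
    using assms x by (intro mult_mono) auto
  moreover have "e * x ^ 3 \<ge> 0"
    using assms B by (intro mult_nonneg_nonneg) auto
  ultimately show "0 \<le> poly [:a, - b, c, e:] x"
    unfolding eq using assms by linarith
  have "a * 1 \<le> 2 * B * x ^ 3" "c * x ^ 2 \<le> 2 * B * x ^ 3" "e * x ^ 3 \<le> 2 * B * x ^ 3"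
    using assms x B by (intro mult_mono; simp)+
  moreover have "b * x > 0"
    using assms by simp
  moreover have "6 * B * x ^ 3 = 2 * B * x ^ 3 + 2 * B * x ^ 3 + 2 * B * x ^ 3"
    by (simp add: algebra_simps)
  ultimately show "poly [:a, - b, c, e:] x < 6 * B * x ^ 3"
    unfolding eq by linarith
qed

lemma add_mult_eq_unique:
  fixes x y z u v :: int
  assumes "u + x * y = v + x * z" "\<bar>u - v\<bar> < x"
  shows "u = v \<and> y = z"
proof -
  have "u - v = x * (z - y)"
    using assms(1) by (simp add: algebra_simps)
  moreover from this have "u - v = 0"
    using assms(2) by (metis dvd_triv_left zdvd_not_zless abs_dvd_iff dvd_abs_iff zero_less_abs_iff)
  ultimately show ?thesis
    using assms(2) by auto
qed

text \<open>The coefficients are read off as base-\<open>x\<close> digits, lowest first; the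
  negative digit \<open>- b\<close> is harmless, as two candidates still differ by less than
  \<open>x\<close>.\<close>

lemma poly_cubic_unique:
  fixes x :: int
  assumes "poly [:a, - b, c, e:] x = poly [:a', - b', c', e':] x"
    and "0 \<le> a" "a < x" "0 \<le> b" "b < x" "0 \<le> c" "c < x"
    and "0 \<le> a'" "a' < x" "0 \<le> b'" "b' < x" "0 \<le> c'" "c' < x"
  shows "a = a' \<and> b = b' \<and> c = c' \<and> e = e'"
proof -
  have 0: "a + x * (- b + x * (c + x * e)) = a' + x * (- b' + x * (c' + x * e'))"
    using assms(1) by simp
  from add_mult_eq_unique[OF this]
  have a: "a = a'" and 1: "- b + x * (c + x * e) = - b' + x * (c' + x * e')"
    using assms by auto
  from add_mult_eq_unique[OF 1]
  have b: "b = b'" and 2: "c + x * e = c' + x * e'"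
    using assms by auto
  from add_mult_eq_unique[OF 2] show ?thesis
    using a b assms by auto
qed

text \<open>Replacing \<open>k\<close> by \<open>k + 1\<close> lowers the exponent of \<open>p\<close> by 1 modulo \<open>m\<close>, so that \<open>m\<close>
  consecutive values of \<open>k\<close> attain every residue.\<close>

lemma exists_power_multiplicity_fact_cong:
  fixes a b c e B :: int
  assumes p: "prime p" and h: "h \<ge> 1" and r: "r < m"
    and bounds: "B \<le> a" "a \<le> 2 * B" "0 < b" "16 ^ h * b < B"
      "B \<le> c" "c \<le> 2 * B" "B \<le> e" "e \<le> 2 * B"
    and dvd: "(int p - 1) * int m dvd b" "(int p - 1) * int m dvd c" "(int p - 1) * int m dvd e"
    and k0: "(8 * B) ^ h < int p ^ k0"
  shows "\<exists>k\<in>{k0..<k0 + m}.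
    [multiplicity p (fact (nat (poly [:a, - b, c, e:] (int p ^ k)) ^ h) :: nat) = r] (mod m)"
proof -
  define t where "t = [:a, - b, c, e:]"
  define v where "v k = int (multiplicity p (fact (nat (poly t (int p ^ k)) ^ h) :: nat))" for k
  have p1: "int p > 1"
    using prime_gt_1_nat[OF p] by simp
  have "1 * b \<le> 16 ^ h * b"
    using bounds by (intro mult_right_mono) auto
  then have bB: "b \<le> B"
    using bounds by linarith
  note signs = coeff_cubic_power_signs[OF bounds h, folded t_def]
  obtain M where M: "\<And>k. (\<forall>i. \<bar>coeff (t ^ h) i\<bar> < int p ^ k) \<Longrightarrow>
      digit_sum p (nat (poly (t ^ h) (int p ^ k))) = (int p - 1) * int k + M"
    using digit_sum_poly_borrow[OF p signs(1-3)] by blast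
  \<comment> \<open>Legendre's formula for the factorial of the \<open>h\<close>-th power, with the
    \<open>(p - 1) * k\<close> of the digit sum moved to the left.\<close>
  have v: "(int p - 1) * (v k + int k) = poly t (int p ^ k) ^ h - M" if k: "k \<ge> k0" for k
  proof -
    have nonneg: "poly t (int p ^ k) \<ge> 0"
      unfolding t_def using p1 bounds bB by (intro poly_cubic_bounds(1)[where B = B]) auto
    have "(8 * B) ^ h < int p ^ k"
      using k0 power_increasing[OF k, of "int p"] p1 by linarith
    then have "\<forall>i. \<bar>coeff (t ^ h) i\<bar> < int p ^ k"
      using signs(4) by (meson le_less_trans)
    from M[OF this] show ?thesis
      using nonneg by (simp add: digit_sum_def v_def nat_power_eq algebra_simps)
  qed
  \<comment> \<open>All values of \<open>t\<close> agree modulo \<open>(p - 1) * m\<close>;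
    cancelling \<open>p - 1\<close> leaves a congruence modulo \<open>m\<close>.\<close>
  have step: "int m dvd (v k + int k) - (v k0 + int k0)" if k: "k \<ge> k0" for k
  proof -
    have cong: "[poly t x = a] (mod ((int p - 1) * int m))" for x
    proof -
      have "poly t x - a = x * (x * (c + x * e) - b)"
        by (simp add: t_def algebra_simps)
      then show ?thesis
        using dvd by (simp add: cong_iff_dvd_diff)
    qed
    have "[poly t (int p ^ k) ^ h = poly t (int p ^ k0) ^ h] (mod ((int p - 1) * int m))"
      by (intro cong_pow cong_trans[OF cong cong_sym[OF cong]])
    then have "(int p - 1) * int m dvd (int p - 1) * ((v k + int k) - (v k0 + int k0))"
      using v[OF k] v[of k0] by (simp add: cong_iff_dvd_diff right_diff_distrib)
    then show ?thesis
      using p1 by simp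
  qed
  \<comment> \<open>\<open>v (k0 + i)\<close> is congruent to \<open>v k0 - i\<close>, so
    \<open>i\<close> counts the steps from \<open>v k0\<close> down to \<open>r\<close>.\<close>
  define i where "i = nat ((v k0 - int r) mod int m)"
  have i: "int i = (v k0 - int r) mod int m" "i < m"
    using r by (simp_all add: i_def nat_less_iff)
  have "int m dvd (v k0 - int r) - int i"
    unfolding i(1) by (rule dvd_minus_mod)
  from dvd_add[OF step[of "k0 + i"] this] have "int m dvd v (k0 + i) - int r"
    by simp
  then have "[int (multiplicity p (fact (nat (poly t (int p ^ (k0 + i))) ^ h) :: nat)) = int r] (mod int m)"
    by (simp add: cong_iff_dvd_diff v_def)
  then have "[multiplicity p (fact (nat (poly t (int p ^ (k0 + i))) ^ h) :: nat) = r] (mod m)"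
    by (simp only: cong_int_iff)
  then show ?thesis
    using i(2) by (intro bexI[of _ "k0 + i"]) (auto simp: t_def)
qed

text \<open>The cubics below have coefficients at most \<open>2 B\<close> with \<open>B \<le> d m p \<cdot> p ^ u\<close>, so that their values
  are below \<open>6 B p ^ (3 k)\<close>, with \<open>k \<le> h (3 + d m p + u) + m\<close>; this is the factor independent
  of \<open>u\<close>.\<close>

definition size_factor :: "nat \<Rightarrow> nat \<Rightarrow> nat \<Rightarrow> nat \<Rightarrow> nat" where
  "size_factor p h d m = 6 * (d * m * p) * p ^ (3 * h * (3 + d * m * p) + 3 * m)"

text \<open>Each of the \<open>Q ^ 4\<close> cubics has a value in \<open>S\<close> at one of
  \<open>m\<close> exponents \<open>k\<close>, and for fixed \<open>k\<close> distinct cubics have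
  distinct values.\<close>

lemma card_multiplicity_fact_cong_ge:
  fixes p h d m u a r :: nat
  assumes p: "prime p" and h: "h \<ge> 1" and a: "a < d" and r: "r < m"
  defines "S \<equiv> {n. n < size_factor p h d m * p ^ ((3 * h + 1) * u) \<and> [n = a] (mod d) \<and>
      [multiplicity p (fact (n ^ h) :: nat) = r] (mod m)}"
  shows "(p ^ u div 32 ^ h) ^ 4 \<le> m * card S"
proof -
  \<comment> \<open>Dividing by \<open>32 ^ h\<close> instead of \<open>16 ^ h\<close> makes the
    inequality \<open>Q16\<close> strict.\<close>
  define Q where "Q = p ^ u div 32 ^ h"
  define W where "W = d * m * (p - 1)"
  \<comment> \<open>Bounding \<open>W\<close> by \<open>V\<close> keeps subtraction out of
    \<open>size_factor\<close>, so its computability rests on sums, products and powers.\<close>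
  define V where "V = d * m * p"
  \<comment> \<open>From \<open>8 \<le> p ^ 3\<close> and \<open>W < p ^ V\<close>, so that
    \<open>p ^ k0\<close> exceeds \<open>(8 * W * p ^ u) ^ h\<close>.\<close>
  define k0 where "k0 = h * (3 + V + u)"
  define B where "B = int W * int p ^ u"
  define A where "A = {..<Q} \<times> {..<Q} \<times> {..<Q} \<times> {..<Q}"
  \<comment> \<open>\<open>W\<close> is divisible by \<open>d\<close> and by
    \<open>(p - 1) * m\<close>, so only \<open>a\<close> survives modulo \<open>d\<close>. The
    \<open>1\<close> in \<open>a1\<close> keeps it positive.\<close>
  define a0 where "a0 j = int a + int W * (int p ^ u + int j)" for j
  define a1 where "a1 j = int W * (1 + int j)" for j
  define a2 where "a2 j = int W * (int p ^ u + int j)" for j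
  define f where "f k = (\<lambda>(j0, j1, j2, j3).
    nat (poly [:a0 j0, - a1 j1, a2 j2, a2 j3:] (int p ^ k)))" for k
  have p2: "p \<ge> 2"
    using p by (rule prime_ge_2_nat)
  have W: "W > 0" "d \<le> W" "W \<le> V"
    using p2 a r by (auto simp: W_def V_def)
  have Qu: "Q \<le> p ^ u"
    by (simp add: Q_def)
  have Q16: "16 ^ h * Q < p ^ u" if "Q > 0"
  proof -
    have "16 ^ h * Q < 32 ^ h * Q"
      using that h by (intro mult_strict_right_mono power_strict_mono) auto
    also have "\<dots> \<le> p ^ u"
      by (simp add: Q_def)
    finally show ?thesis .
  qed
  have B: "B > 0"
    using W p2 by (simp add: B_def)
  have a0: "B \<le> a0 j" "a0 j \<le> 2 * B" if "j < Q" for j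
  proof -
    \<comment> \<open>The spare unit is worth one \<open>W\<close>, which absorbs
      \<open>a < d \<le> W\<close>.\<close>
    have "Suc j \<le> p ^ u"
      using that Qu by linarith
    then have "int W * int (p ^ u + Suc j) \<le> int W * int (p ^ u + p ^ u)"
      by (intro mult_left_mono of_nat_mono) auto
    then show "a0 j \<le> 2 * B"
      using a W by (simp add: a0_def B_def algebra_simps)
    show "B \<le> a0 j"
      by (simp add: a0_def B_def algebra_simps)
  qed
  have a1: "0 < a1 j" "16 ^ h * a1 j < B" if "j < Q" for j
  proof -
    show "0 < a1 j"
      using W by (simp add: a1_def)
    have "16 ^ h * (1 + j) \<le> 16 ^ h * Q"
      using that by (intro mult_left_mono) auto
    also have "\<dots> < p ^ u"
      using Q16 that by simp
    finally have "int (W * (16 ^ h * (1 + j))) < int (W * p ^ u)"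
      using W unfolding of_nat_less_iff by simp
    then show "16 ^ h * a1 j < B"
      by (simp add: a1_def B_def algebra_simps)
  qed
  have a1B: "a1 j \<le> B" if "j < Q" for j
  proof -
    have "1 * a1 j \<le> 16 ^ h * a1 j"
      using a1[OF that] by (intro mult_right_mono) auto
    then show ?thesis
      using a1[OF that] by linarith
  qed
  have a2: "B \<le> a2 j" "a2 j \<le> 2 * B" if "j < Q" for j
    using a0(2)[OF that] by (simp_all add: a0_def a2_def B_def algebra_simps)
  have k0_large: "(8 * B) ^ h < int p ^ k0"
  proof -
    have "8 * W < p ^ 3 * p ^ V"
    proof (rule mult_le_less_imp_less)
      show "8 \<le> p ^ 3"
        using power_mono[OF p2, of 3] by simp
      show "W < p ^ V"
        using W less_exp[of V] power_mono[OF p2, of V] by linarith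
    qed auto
    then have "8 * W * p ^ u < p ^ 3 * p ^ V * p ^ u"
      using p2 by simp
    then have "(8 * W * p ^ u) ^ h < (p ^ (3 + V + u)) ^ h"
      using h by (intro power_strict_mono) (auto simp: power_add)
    also have "\<dots> = p ^ k0"
      by (simp add: k0_def mult.commute flip: power_mult)
    finally have "int ((8 * W * p ^ u) ^ h) < int (p ^ k0)"
      by (simp only: of_nat_less_iff)
    then show ?thesis
      by (simp add: B_def mult.assoc)
  qed
  have "8 * B \<le> (8 * B) ^ h"
    using B h by (intro self_le_power) auto
  then have Bk: "8 * B < int p ^ k" if "k \<ge> k0" for k
    using k0_large power_increasing[OF that, of "int p"] p2 by linarith
  have inj: "inj_on (f k) A" if k: "k \<ge> k0" for k
  proof (rule inj_onI)
    fix s t assume s: "s \<in> A" and t: "t \<in> A" and eq: "f k s = f k t"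
    obtain j0 j1 j2 j3 where j: "s = (j0, j1, j2, j3)" "j0 < Q" "j1 < Q" "j2 < Q" "j3 < Q"
      using s by (auto simp: A_def)
    obtain l0 l1 l2 l3 where l: "t = (l0, l1, l2, l3)" "l0 < Q" "l1 < Q" "l2 < Q" "l3 < Q"
      using t by (auto simp: A_def)
    have x: "int p ^ k \<ge> 1"
      using p2 by simp
    have "poly [:a0 j0, - a1 j1, a2 j2, a2 j3:] (int p ^ k) \<ge> 0"
      using j x a0 a1 a1B a2 by (intro poly_cubic_bounds(1)[where B = B]) auto
    moreover have "poly [:a0 l0, - a1 l1, a2 l2, a2 l3:] (int p ^ k) \<ge> 0"
      using l x a0 a1 a1B a2 by (intro poly_cubic_bounds(1)[where B = B]) auto
    ultimately have "poly [:a0 j0, - a1 j1, a2 j2, a2 j3:] (int p ^ k) =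
        poly [:a0 l0, - a1 l1, a2 l2, a2 l3:] (int p ^ k)"
      using eq unfolding f_def j(1) l(1) prod.case by linarith
    then have "a0 j0 = a0 l0 \<and> a1 j1 = a1 l1 \<and> a2 j2 = a2 l2 \<and> a2 j3 = a2 l3"
      by (rule poly_cubic_unique) (use a0[OF j(2)] a0[OF l(2)] a1[OF j(3)] a1[OF l(3)] a1B[OF j(3)] a1B[OF l(3)]
        a2[OF j(4)] a2[OF l(4)] Bk[OF k] B in linarith)+
    then show "s = t"
      using W by (simp add: j(1) l(1) a0_def a1_def a2_def)
  qed
  have fin: "finite S"
    by (simp add: S_def)
  have "A \<subseteq> (\<Union>k\<in>{k0..<k0 + m}. {t \<in> A. f k t \<in> S})"
  proof
    fix t assume t: "t \<in> A"
    obtain j0 j1 j2 j3 where j: "t = (j0, j1, j2, j3)" "j0 < Q" "j1 < Q" "j2 < Q" "j3 < Q"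
      using t by (auto simp: A_def)
    have pm: "(int p - 1) * int m dvd int W"
      using p2 by (simp add: W_def of_nat_diff)
    obtain k where k: "k \<in> {k0..<k0 + m}"
      and res: "[multiplicity p (fact (nat (poly [:a0 j0, - a1 j1, a2 j2, a2 j3:] (int p ^ k)) ^ h) :: nat) = r] (mod m)"
      using exists_power_multiplicity_fact_cong[OF p h r a0[OF j(2)] a1[OF j(3)] a2[OF j(4)] a2[OF j(5)]
        _ _ _ k0_large] pm by (auto simp: a1_def a2_def)
    have x: "int p ^ k \<ge> 1"
      using p2 by simp
    have n: "0 \<le> poly [:a0 j0, - a1 j1, a2 j2, a2 j3:] (int p ^ k)"
        "poly [:a0 j0, - a1 j1, a2 j2, a2 j3:] (int p ^ k) < 6 * B * (int p ^ k) ^ 3"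
      using poly_cubic_bounds[OF a0[OF j(2)] a1(1)[OF j(3)] a1B[OF j(3)] a2[OF j(4)] a2[OF j(5)] x]
      by auto
    have "[poly [:a0 j0, - a1 j1, a2 j2, a2 j3:] (int p ^ k) = int a] (mod int d)"
    proof -
      have "poly [:a0 j0, - a1 j1, a2 j2, a2 j3:] (int p ^ k) - int a =
          int W * (int p ^ u + int j0 + int p ^ k * (- (1 + int j1) + int p ^ k *
            (int p ^ u + int j2 + int p ^ k * (int p ^ u + int j3))))"
        by (simp add: a0_def a1_def a2_def algebra_simps)
      moreover have "int d dvd int W"
        by (simp add: W_def)
      ultimately show ?thesis
        by (simp add: cong_iff_dvd_diff)
    qed
    then have "[int (f k t) = int a] (mod int d)"
      using n(1) by (simp add: f_def j(1))
    then have "[f k t = a] (mod d)"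
      by (simp only: cong_int_iff)
    moreover have "f k t < size_factor p h d m * p ^ ((3 * h + 1) * u)"
    proof -
      have "int (f k t) < int (6 * (W * p ^ u) * (p ^ k) ^ 3)"
        using n by (simp add: f_def j(1) B_def)
      then have "f k t < 6 * (W * p ^ u) * (p ^ k) ^ 3"
        by (simp only: of_nat_less_iff)
      also have "\<dots> \<le> 6 * (V * p ^ u) * (p ^ (k0 + m)) ^ 3"
        using W k p2 by (intro mult_mono power_mono power_increasing) auto
      also have "\<dots> = size_factor p h d m * p ^ ((3 * h + 1) * u)"
        by (simp add: size_factor_def k0_def V_def algebra_simps flip: power_mult power_add)
      finally show ?thesis .
    qed
    ultimately have "f k t \<in> S"
      using res by (simp add: S_def f_def j(1))
    then show "t \<in> (\<Union>k\<in>{k0..<k0 + m}. {t \<in> A. f k t \<in> S})"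
      using k t by blast
  qed
  then have "card A \<le> card (\<Union>k\<in>{k0..<k0 + m}. {t \<in> A. f k t \<in> S})"
    by (intro card_mono) (auto simp: A_def)
  also have "\<dots> \<le> (\<Sum>k\<in>{k0..<k0 + m}. card {t \<in> A. f k t \<in> S})"
    by (rule card_UN_le) simp
  also have "\<dots> \<le> (\<Sum>k\<in>{k0..<k0 + m}. card S)"
  proof (rule sum_mono)
    fix k assume "k \<in> {k0..<k0 + m}"
    then show "card {t \<in> A. f k t \<in> S} \<le> card S"
      by (intro card_inj_on_le[of "f k"] inj_on_subset[OF inj] fin) auto
  qed
  also have "\<dots> = m * card S"
    by simp
  finally show ?thesis
    by (simp add: A_def card_cartesian_product Q_def numeral_eq_Suc)
qed

subsection \<open>Computability of the bound\<close>

text \<open>Values on lists of other lengths are meaningless, so agreement on length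
  \<open>k\<close> suffices; functions can then be composed without matching the exact terms of
  \<open>total_recursive\<close>.\<close>

definition computable :: "nat \<Rightarrow> (nat list \<Rightarrow> nat) \<Rightarrow> bool" where
  "computable k F \<longleftrightarrow> (\<exists>f. total_recursive k f \<and> (\<forall>xs. length xs = k \<longrightarrow> f xs = F xs))"

lemma computable_nth: "i < k \<Longrightarrow> computable k (\<lambda>xs. xs ! i)"
  unfolding computable_def by (blast intro: total_recursive.proj)

lemma computable_comp1:
  assumes f: "computable 1 f" and g: "computable k g"
  shows "computable k (\<lambda>xs. f [g xs])"
proof -
  obtain f' g' where f': "total_recursive 1 f'" "\<And>xs. length xs = 1 \<Longrightarrow> f' xs = f xs"
    and g': "total_recursive k g'" "\<And>xs. length xs = k \<Longrightarrow> g' xs = g xs"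
    using assms unfolding computable_def by blast
  have "total_recursive k (\<lambda>xs. f' (map (\<lambda>g. g xs) [g']))"
    by (rule total_recursive.comp) (use f' g' in auto)
  then show ?thesis
    unfolding computable_def using f'(2) g'(2) by (intro exI conjI) auto
qed

lemma computable_comp2:
  assumes f: "computable 2 f" and g: "computable k g1" "computable k g2"
  shows "computable k (\<lambda>xs. f [g1 xs, g2 xs])"
proof -
  obtain f' g1' g2' where f': "total_recursive 2 f'" "\<And>xs. length xs = 2 \<Longrightarrow> f' xs = f xs"
    and g1': "total_recursive k g1'" "\<And>xs. length xs = k \<Longrightarrow> g1' xs = g1 xs"
    and g2': "total_recursive k g2'" "\<And>xs. length xs = k \<Longrightarrow> g2' xs = g2 xs"
    using assms unfolding computable_def by blast
  have "total_recursive k (\<lambda>xs. f' (map (\<lambda>g. g xs) [g1', g2']))"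
    by (rule total_recursive.comp) (use f' g1' g2' in \<open>auto simp: numeral_2_eq_2\<close>)
  then show ?thesis
    unfolding computable_def using f'(2) g1'(2) g2'(2) by (intro exI conjI) auto
qed

lemma computable_prim_rec:
  assumes f: "computable k f" and g: "computable (Suc (Suc k)) g"
  shows "computable (Suc k) (\<lambda>xs. rec_nat (f (tl xs)) (\<lambda>y v. g (y # v # tl xs)) (hd xs))"
proof -
  obtain f' g' where f': "total_recursive k f'" "\<And>xs. length xs = k \<Longrightarrow> f' xs = f xs"
    and g': "total_recursive (Suc (Suc k)) g'" "\<And>xs. length xs = Suc (Suc k) \<Longrightarrow> g' xs = g xs"
    using assms unfolding computable_def by blast
  show ?thesis
    unfolding computable_def
    using total_recursive.prim_rec[OF f'(1) g'(1)] f'(2) g'(2) by (intro exI conjI) auto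
qed

lemma computable_Suc: "computable k f \<Longrightarrow> computable k (\<lambda>xs. Suc (f xs))"
  using computable_comp1[of "\<lambda>xs. Suc (xs ! 0)"] total_recursive.succ
  unfolding computable_def by fastforce

lemma computable_const: "computable k (\<lambda>xs. c)"
proof (induction c)
  case 0
  show ?case
    unfolding computable_def by (blast intro: total_recursive.zero)
qed (rule computable_Suc)

lemma computable_add:
  assumes "computable k f" "computable k g"
  shows "computable k (\<lambda>xs. f xs + g xs)"
proof -
  have rec: "rec_nat y (\<lambda>_. Suc) x = x + y" for x y :: nat
    by (induction x) auto
  have "computable (Suc 1) (\<lambda>xs. rec_nat (tl xs ! 0) (\<lambda>y v. Suc ((y # v # tl xs) ! 1)) (hd xs))"
    by (intro computable_prim_rec[of 1 "\<lambda>xs. xs ! 0" "\<lambda>xs. Suc (xs ! 1)"]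
        computable_Suc computable_nth) auto
  then have "computable 2 (\<lambda>xs. rec_nat (tl xs ! 0) (\<lambda>y v. Suc ((y # v # tl xs) ! 1)) (hd xs))"
    by (simp only: numeral_2_eq_2 One_nat_def)
  from computable_comp2[OF this assms] show ?thesis
    by (simp add: rec)
qed

lemma computable_mult:
  assumes "computable k f" "computable k g"
  shows "computable k (\<lambda>xs. f xs * g xs)"
proof -
  have rec: "rec_nat 0 (\<lambda>_ v. v + y) x = x * y" for x y :: nat
    by (induction x) auto
  \<comment> \<open>In \<open>y # v # tl xs\<close> index 0 is the counter, 1 the value so far and 2
    the parameter.\<close>
  have "computable (Suc 1) (\<lambda>xs. rec_nat 0 (\<lambda>y v. (y # v # tl xs) ! 1 + (y # v # tl xs) ! 2) (hd xs))"
    by (intro computable_prim_rec[of 1 "\<lambda>xs. 0" "\<lambda>xs. xs ! 1 + xs ! 2"]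
        computable_add computable_nth computable_const) auto
  then have "computable 2 (\<lambda>xs. rec_nat 0 (\<lambda>y v. (y # v # tl xs) ! 1 + (y # v # tl xs) ! 2) (hd xs))"
    by (simp only: numeral_2_eq_2 One_nat_def)
  from computable_comp2[OF this assms] show ?thesis
    by (simp add: rec)
qed

lemma computable_power:
  assumes "computable k f" "computable k g"
  shows "computable k (\<lambda>xs. f xs ^ g xs)"
proof -
  have rec: "rec_nat (Suc 0) (\<lambda>_ v. v * y) x = y ^ x" for x y :: nat
    by (induction x) auto
  have "computable (Suc 1) (\<lambda>xs. rec_nat 1 (\<lambda>y v. (y # v # tl xs) ! 1 * (y # v # tl xs) ! 2) (hd xs))"
    by (intro computable_prim_rec[of 1 "\<lambda>xs. 1" "\<lambda>xs. xs ! 1 * xs ! 2"]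
        computable_mult computable_nth computable_const) auto
  then have "computable 2 (\<lambda>xs. rec_nat 1 (\<lambda>y v. (y # v # tl xs) ! 1 * (y # v # tl xs) ! 2) (hd xs))"
    by (simp only: numeral_2_eq_2 One_nat_def)
  \<comment> \<open>The exponent is the recursion variable and comes first, hence the swapped
    assumptions.\<close>
  from computable_comp2[OF this assms(2,1)] show ?thesis
    by (simp add: rec)
qed

text \<open>With \<open>u = 5 h\<close> one has \<open>p ^ u \<ge> 32 ^ h\<close>, so at least one cubic is available.\<close>

definition residue_bound :: "nat \<Rightarrow> nat \<Rightarrow> nat \<Rightarrow> nat \<Rightarrow> nat" where
  "residue_bound p h d m = size_factor p h d m * p ^ ((3 * h + 1) * (5 * h))"

lemma effectively_computable_residue_bound: "effectively_computable4 residue_bound"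
proof -
  have "computable 4 (\<lambda>xs. residue_bound (xs ! 0) (xs ! 1) (xs ! 2) (xs ! 3))"
    unfolding residue_bound_def size_factor_def
    by (intro computable_mult computable_add computable_power computable_const computable_nth) auto
  then obtain f where f: "total_recursive 4 f"
    "\<And>xs. length xs = 4 \<Longrightarrow> f xs = residue_bound (xs ! 0) (xs ! 1) (xs ! 2) (xs ! 3)"
    unfolding computable_def by blast
  have "residue_bound i j k l = f [i, j, k, l]" for i j k l
    using f(2)[of "[i, j, k, l]"] by (simp add: numeral_eq_Suc)
  with f(1) show ?thesis
    unfolding effectively_computable4_def by blast
qed

section \<open>Deduction of both assertions from the count\<close>

lemma residues_below_residue_bound:
  assumes p: "prime p" and h: "h \<ge> 1" and a: "a < d" and r: "r < m"
  shows "\<exists>n < residue_bound p h d m. [n = a] (mod d) \<and> multiplicity p (fact (n ^ h) :: nat) mod m = r"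
proof -
  define S where "S = {n. n < size_factor p h d m * p ^ ((3 * h + 1) * (5 * h)) \<and> [n = a] (mod d) \<and>
      [multiplicity p (fact (n ^ h) :: nat) = r] (mod m)}"
  have "32 ^ h \<le> p ^ (5 * h)"
    using power_mono[OF prime_ge_2_nat[OF p], of "5 * h"] by (simp add: power_mult)
  then have "0 < (p ^ (5 * h) div 32 ^ h) ^ 4"
    by (simp add: div_greater_zero_iff)
  also have "\<dots> \<le> m * card S"
    unfolding S_def by (rule card_multiplicity_fact_cong_ge[OF assms])
  finally have "S \<noteq> {}"
    by auto
  then show ?thesis
    using r by (auto simp: S_def residue_bound_def cong_def)
qed

text \<open>Take the largest \<open>u\<close> with \<open>p ^ u \<le> y\<close>, where
  \<open>y\<close> is the \<open>g\<close>-th root of \<open>x / K\<close>. The numbers counted then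
  lie below \<open>x\<close>, and their number is at least a constant times
  \<open>y ^ 4\<close>.\<close>

lemma eventually_card_multiplicity_fact_cong_ge:
  fixes p h d m :: nat
  assumes p: "prime p" and h: "h \<ge> 1" and d: "d \<ge> 1" and m: "m \<ge> 1"
  shows "\<exists>c::real. c > 0 \<and> (\<forall>a<d. \<forall>r<m. \<forall>\<^sub>F x::real in at_top.
    real (card {n::nat. real n < x \<and> [n = a] (mod d) \<and>
        [multiplicity p (fact (n ^ h) :: nat) = r] (mod m)})
      \<ge> c * x powr (4 / (3 * real h + 1)))"
proof -
  define K where "K = real (size_factor p h d m)"
  define g where "g = 3 * h + 1"
  \<comment> \<open>The factor \<open>p\<close> is lost through \<open>y < p ^ (u + 1)\<close>, the
    factor \<open>2 * 32 ^ h\<close> through integer division.\<close>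
  define D where "D = 2 * 32 ^ h * real p"
  define c where "c = 1 / (real m * D ^ 4 * K powr (4 / real g))"
  have p2: "p \<ge> 2"
    using p by (rule prime_ge_2_nat)
  have K: "K > 0"
    using p2 d m by (simp add: K_def size_factor_def)
  have D: "D > 0"
    using p2 by (simp add: D_def)
  have c: "c > 0"
    using K D m by (simp add: c_def)
  have "real (card {n::nat. real n < x \<and> [n = a] (mod d) \<and>
        [multiplicity p (fact (n ^ h) :: nat) = r] (mod m)}) \<ge> c * x powr (4 / real g)"
    if a: "a < d" and r: "r < m" and x: "x \<ge> K * real p ^ (g * (5 * h))" for a r x
  proof -
    define T where "T = {n::nat. real n < x \<and> [n = a] (mod d) \<and>
        [multiplicity p (fact (n ^ h) :: nat) = r] (mod m)}"
    define y where "y = (x / K) powr (1 / real g)"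
    have g: "g > 0"
      by (simp add: g_def)
    have xK: "x / K \<ge> real p ^ (g * (5 * h))"
      using x K by (simp add: field_simps)
    have x0: "x / K > 0"
      by (rule less_le_trans[OF _ xK]) (use p2 in simp)
    have yg: "y ^ g = x / K"
      using x0 K g by (simp add: y_def powr_powr zero_less_divide_iff flip: powr_realpow')
    have y0: "y > 0"
      using x0 by (auto simp: y_def)
    \<comment> \<open>The threshold on \<open>x\<close> forces \<open>u \<ge> 5 * h\<close>; the
      quotient \<open>p ^ u div 32 ^ h\<close> is then at least 1 and rounding costs at most a
      factor 2.\<close>
    have "(real p ^ (5 * h)) ^ g \<le> y ^ g"
      using xK by (simp add: yg mult.commute flip: power_mult)
    then have y5: "real p ^ (5 * h) \<le> y"
      using y0 g by (simp add: power_mono_iff)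
    moreover have "1 \<le> real p ^ (5 * h)"
      using p2 by simp
    ultimately have "1 \<le> nat \<lfloor>y\<rfloor>"
      by (simp add: le_nat_floor)
    then obtain u where u: "p ^ u \<le> nat \<lfloor>y\<rfloor>" "nat \<lfloor>y\<rfloor> < p ^ (u + 1)"
      using ex_power_ivl1[OF p2] by blast
    have uy: "real p ^ u \<le> y"
    proof -
      have "real (p ^ u) \<le> real (nat \<lfloor>y\<rfloor>)"
        using u(1) by (simp only: of_nat_le_iff)
      also have "\<dots> \<le> y"
        using y0 by (intro of_nat_floor) simp
      finally show ?thesis
        by simp
    qed
    have yu: "y < real p ^ (u + 1)"
    proof -
      have "y < real (nat \<lfloor>y\<rfloor> + 1)"
        using y0 by simp linarith
      also have "\<dots> \<le> real (p ^ (u + 1))"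
        using u(2) unfolding of_nat_le_iff by linarith
      finally show ?thesis
        by simp
    qed
    have "real p ^ (5 * h) < real p ^ (u + 1)"
      using y5 yu by linarith
    then have "5 * h \<le> u"
      using p2 by (simp add: power_strict_increasing_iff del: power_Suc)
    then have p32: "32 ^ h \<le> p ^ u"
      using power_mono[OF p2, of "5 * h"] power_increasing[of "5 * h" u p] p2
      by (simp add: power_mult)
    have Q: "real p ^ u \<le> 2 * 32 ^ h * real (p ^ u div 32 ^ h)"
    proof -
      have "p ^ u div 32 ^ h \<ge> 1"
        using p32 by (simp add: Suc_le_eq div_greater_zero_iff)
      then have "32 ^ h \<le> 32 ^ h * (p ^ u div 32 ^ h)"
        by simp
      moreover have "p ^ u mod 32 ^ h < 32 ^ h"
        by simp
      moreover have "p ^ u = 32 ^ h * (p ^ u div 32 ^ h) + p ^ u mod 32 ^ h"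
        by simp
      ultimately have "p ^ u \<le> 2 * 32 ^ h * (p ^ u div 32 ^ h)"
        by linarith
      then have "real (p ^ u) \<le> real (2 * 32 ^ h * (p ^ u div 32 ^ h))"
        by (simp only: of_nat_le_iff)
      then show ?thesis
        by simp
    qed
    have "y \<le> D * real (p ^ u div 32 ^ h)"
      using yu mult_left_mono[OF Q, of "real p"] by (simp add: D_def algebra_simps)
    then have "y ^ 4 \<le> (D * real (p ^ u div 32 ^ h)) ^ 4"
      using y0 by (intro power_mono) auto
    also have "\<dots> = D ^ 4 * real ((p ^ u div 32 ^ h) ^ 4)"
      by (simp add: power_mult_distrib)
    also have "\<dots> \<le> D ^ 4 * real (m * card T)"
    proof (intro mult_left_mono)
      have "real n < x" if "n < size_factor p h d m * p ^ (g * u)" for n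
      proof -
        have "real n < K * (real p ^ u) ^ g"
          using that by (simp add: K_def mult.commute flip: power_mult of_nat_power of_nat_mult)
        also have "\<dots> \<le> K * y ^ g"
          using uy K by (intro mult_left_mono power_mono) auto
        also have "\<dots> = x"
          using K by (simp add: yg)
        finally show ?thesis .
      qed
      then have sub: "{n. n < size_factor p h d m * p ^ ((3 * h + 1) * u) \<and> [n = a] (mod d) \<and>
          [multiplicity p (fact (n ^ h) :: nat) = r] (mod m)} \<subseteq> T"
        unfolding T_def g_def by blast
      \<comment> \<open>Finiteness matters for monotonicity, as \<open>card\<close> of an infinite
        set is 0.\<close>
      have "T \<subseteq> {..nat \<lceil>x\<rceil>}"
        unfolding T_def by (auto simp: le_nat_iff) linarith
      then have fin: "finite T"
        using finite_subset by blast
      have "(p ^ u div 32 ^ h) ^ 4 \<le> m * card T"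
        using card_multiplicity_fact_cong_ge[OF p h a r, of u] card_mono[OF fin sub]
        by (meson le_trans mult_le_mono2)
      then show "real ((p ^ u div 32 ^ h) ^ 4) \<le> real (m * card T)"
        by (simp only: of_nat_le_iff)
    qed (use D in simp)
    finally have "y ^ 4 \<le> D ^ 4 * real m * real (card T)"
      by (simp add: mult.assoc)
    moreover have "y ^ 4 = x powr (4 / real g) / K powr (4 / real g)"
    proof -
      have "y ^ 4 = y powr 4"
        using y0 by (simp add: powr_numeral)
      also have "\<dots> = (x / K) powr (4 / real g)"
        by (simp add: y_def powr_powr)
      also have "\<dots> = x powr (4 / real g) / K powr (4 / real g)"
        by (rule powr_divide)
      finally show ?thesis .
    qed
    ultimately show ?thesis
      unfolding T_def[symmetric] using K D m by (simp add: c_def field_simps)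
  qed
  then have "\<forall>a<d. \<forall>r<m. \<forall>\<^sub>F x::real in at_top.
    real (card {n::nat. real n < x \<and> [n = a] (mod d) \<and>
        [multiplicity p (fact (n ^ h) :: nat) = r] (mod m)}) \<ge> c * x powr (4 / real g)"
    by (blast intro: eventually_at_top_linorderI)
  moreover have "real g = 3 * real h + 1"
    by (simp add: g_def)
  ultimately show ?thesis
    using c by auto
qed

theorem theorem2:
  shows "(\<forall>(p::nat) (h::nat) (d::nat) (m::nat).
            prime p \<and> h \<ge> 2 \<and> d \<ge> 1 \<and> m \<ge> 1 \<longrightarrow>
            (\<exists>c::real. c > 0 \<and>
               (\<forall>a<d. \<forall>r<m. \<forall>\<^sub>F x::real in at_top.
                  real (card {n::nat. real n < x \<and> [n = a] (mod d) \<and>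
                                [multiplicity p (fact (n ^ h) :: nat) = r] (mod m)})
                    \<ge> c * x powr (4 / (3 * real h + 1))))) \<and>
         (\<exists>C :: nat \<Rightarrow> nat \<Rightarrow> nat \<Rightarrow> nat \<Rightarrow> nat. effectively_computable4 C \<and>
            (\<forall>(p::nat) (h::nat) (d::nat) (m::nat).
               prime p \<and> h \<ge> 2 \<and> d \<ge> 1 \<and> m \<ge> 1 \<longrightarrow>
               (\<forall>a<d. {multiplicity p (fact (n ^ h) :: nat) mod m | n::nat.
                          n < C p h d m \<and> [n = a] (mod d)} = {0..<m})))"
proof (intro conjI exI[of _ residue_bound] allI impI effectively_computable_residue_bound)
  fix p h d m :: nat
  assume *: "prime p \<and> h \<ge> 2 \<and> d \<ge> 1 \<and> m \<ge> 1"
  then show "\<exists>c::real. c > 0 \<and> (\<forall>a<d. \<forall>r<m. \<forall>\<^sub>F x::real in at_top.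
      real (card {n::nat. real n < x \<and> [n = a] (mod d) \<and>
          [multiplicity p (fact (n ^ h) :: nat) = r] (mod m)})
        \<ge> c * x powr (4 / (3 * real h + 1)))"
    by (intro eventually_card_multiplicity_fact_cong_ge) auto
  fix a assume "a < d"
  then have res: "\<exists>n < residue_bound p h d m. [n = a] (mod d) \<and>
      multiplicity p (fact (n ^ h) :: nat) mod m = r" if "r < m" for r
    using * that by (intro residues_below_residue_bound) auto
  show "{multiplicity p (fact (n ^ h) :: nat) mod m | n::nat.
      n < residue_bound p h d m \<and> [n = a] (mod d)} = {0..<m}"
  proof (intro equalityI subsetI)
    fix r assume "r \<in> {0..<m}"
    with res[of r] show "r \<in> {multiplicity p (fact (n ^ h) :: nat) mod m | n::nat.
        n < residue_bound p h d m \<and> [n = a] (mod d)}"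
      by auto
  qed (use * in auto)
qed

end
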